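(* Let $A\subset\mathbb{R}$ be a finite set with $|A|\ge 2$ and let $\delta = 1/5$. Then there are two disjoint subsets $B$ and $C$ of $A$ such that $A = B\sqcup C$ and $$\max\{\mathbf{E}^+(B),\ \mathbf{E}^\times(C)\} \lesssim |A|^{3-\delta}.$$
   Context: For finite $X\subset\mathbb{R}$, the additive energy is $\mathbf{E}^+(X)=|\{(x_1,x_2,x_3,x_4)\in X^4 : x_1+x_2=x_3+x_4\}|$ and the multiplicative energy is $\mathbf{E}^\times(X)=|\{(x_1,x_2,x_3,x_4)\in X^4 : x_1x_2=x_3x_4\}|$. Notation: $U\lesssim V$ means $U = O(V\cdot\log^{c}|A|)$ for some absolute constant $c>0$, with an absolute implied constant. *)

theory Defs
  imports Complex_Main
begin

definition additive_energy :: "real set \<Rightarrow> nat" where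
  "additive_energy X =
     card {(x1, x2, x3, x4). x1 \<in> X \<and> x2 \<in> X \<and> x3 \<in> X \<and> x4 \<in> X \<and> x1 + x2 = x3 + x4}"

definition multiplicative_energy :: "real set \<Rightarrow> nat" where
  "multiplicative_energy X =
     card {(x1, x2, x3, x4). x1 \<in> X \<and> x2 \<in> X \<and> x3 \<in> X \<and> x4 \<in> X \<and> x1 * x2 = x3 * x4}"

end

theory Submission
  imports Defs "HOL-Analysis.Convex" "HOL-Analysis.L2_Norm"
begin

text \<open>
The heart of the matter is that a set $A$ of nonzero reals with $\mathbf{E}^\times(A) \ge M$ contains a nonempty
$A'$ whose additive energy is at most $|A'|^4\, n^{3/2} / M$ up to logarithms, for any $n \ge |A|$. Since
$\mathbf{E}^+(\cdot)^{1/4}$ is subadditive, the condition $\mathbf{E}^+(B) \le \kappa |B|^4$ is stable under disjoint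
unions; a maximal $B \subseteq A$ satisfying it therefore leaves a complement of multiplicative energy
below $M$. With $M = |A|^{14/5}$ this gives $\mathbf{E}^+(B) \lesssim |A|^{27/10}$.

The set $A'$ comes from the Szemeredi--Trotter bound, which is needed only for points forming a
Cartesian product. There it is elementary: cut the grid into $r \times r$ cells, note that a line of
nonzero slope meets at most $2r$ of them, and count pairs of points in a common cell, each of which
determines at most one line.
\<close>

section \<open>Counting by fibres and by collisions\<close>

lemma card_eq_sum_fibres:
  assumes "finite P" "finite V" "f ` P \<subseteq> V"
  shows "card P = (\<Sum>v\<in>V. card {p\<in>P. f p = v})"
  using sum.group[OF assms, of "\<lambda>_. 1::nat"] by simp

text \<open>Turns every energy below into a sum of products of representation counts. Two sets and
  two maps are allowed because the mixed energy of \<open>A\<close> and \<open>B\<close> compares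
  differences within \<open>A\<close> to differences within \<open>B\<close>.\<close>

lemma card_collisions_eq_sum:
  assumes "finite P" "finite Q" "finite V" "f ` P \<subseteq> V"
  shows "card {(p, q). p \<in> P \<and> q \<in> Q \<and> f p = g q}
    = (\<Sum>v\<in>V. card {p\<in>P. f p = v} * card {q\<in>Q. g q = v})"
proof -
  let ?T = "{(p, q). p \<in> P \<and> q \<in> Q \<and> f p = g q}"
  have fin: "finite ?T"
    by (rule finite_subset[of _ "P \<times> Q"]) (use assms in auto)
  have "card ?T = (\<Sum>v\<in>V. card {t\<in>?T. f (fst t) = v})"
    by (rule card_eq_sum_fibres[OF fin]) (use assms in auto)
  also have "\<dots> = (\<Sum>v\<in>V. card ({p\<in>P. f p = v} \<times> {q\<in>Q. g q = v}))"
    by (intro sum.cong refl arg_cong[where f = card]) auto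
  finally show ?thesis by (simp add: card_cartesian_product)
qed

text \<open>Cauchy-Schwarz over the fibres of \<open>f\<close>. It is applied to the points of one
  line, with \<open>f\<close> sending a point to its grid cell.\<close>

lemma card_squared_le_collisions:
  assumes "finite P"
  shows "(card P)\<^sup>2 \<le> card (f ` P) * card {(p, q). p \<in> P \<and> q \<in> P \<and> f p = f q}"
proof -
  have "(real (card P))\<^sup>2 = (\<Sum>v\<in>f ` P. real (card {p\<in>P. f p = v}))\<^sup>2"
    using card_eq_sum_fibres[OF assms, of "f ` P" f] assms by simp
  also have "\<dots> \<le> (\<Sum>v\<in>f ` P. (real (card {p\<in>P. f p = v}))\<^sup>2) * card (f ` P)"
    by (rule sum_squared_le_sum_of_squares)
  also have "(\<Sum>v\<in>f ` P. (real (card {p\<in>P. f p = v}))\<^sup>2)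
      = card {(p, q). p \<in> P \<and> q \<in> P \<and> f p = f q}"
    using card_collisions_eq_sum[OF assms assms, of "f ` P" f f] assms
    by (simp add: power2_eq_square)
  finally show ?thesis
    unfolding of_nat_mult[symmetric] of_nat_power[symmetric] of_nat_le_iff
    by (simp add: mult.commute)
qed

section \<open>Incidences between a Cartesian product and lines\<close>

text \<open>Elements are ranked in increasing order and the ranks cut into intervals of equal
  length. The index function is monotone on the whole type, not just on \<open>X\<close>, so that it
  can be composed with an affine map freely.\<close>

lemma ex_block_decomposition:
  fixes X :: "'a::linorder set"
  assumes "finite X" "1 \<le> r" "r \<le> card X"
  obtains b :: "'a \<Rightarrow> nat" where "mono b" "\<And>x. x \<in> X \<Longrightarrow> b x < r"
    "\<And>i. r * card {x\<in>X. b x = i} \<le> 2 * card X"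
proof
  \<comment> \<open>The extra 1 forces \<open>card X < w * r\<close>, so that every index stays
    below \<open>r\<close>; its cost \<open>r * w \<le> card X + r\<close> is absorbed by
    \<open>r \<le> card X\<close>.\<close>
  define w where "w = card X div r + 1"
  define rank where "rank x = card {y\<in>X. y < x}" for x
  have rank_mono: "rank x \<le> rank y" if "x \<le> y" for x y
    unfolding rank_def using that assms(1) by (intro card_mono) auto
  have rank_strict: "rank x < rank y" if "x \<in> X" "x < y" for x y
    unfolding rank_def using that assms(1) by (intro psubset_card_mono) auto
  have rank_less: "rank x < card X" if "x \<in> X" for x
    unfolding rank_def using that assms(1) by (intro psubset_card_mono) auto
  have wr: "card X < w * r"
    using assms(2) dividend_less_div_times[of r "card X"] by (simp add: w_def)
  show "mono (\<lambda>x. rank x div w)"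
    by (intro monoI div_le_mono rank_mono)
  show "rank x div w < r" if "x \<in> X" for x
    using rank_less[OF that] wr by (metis less_mult_imp_div_less less_trans mult.commute)
  show "r * card {x\<in>X. rank x div w = i} \<le> 2 * card X" for i
  proof -
    have w0: "w > 0" by (simp add: w_def)
    have inj: "inj_on rank {x\<in>X. rank x div w = i}"
    proof (rule inj_onI)
      fix x y assume "x \<in> {x\<in>X. rank x div w = i}" "y \<in> {x\<in>X. rank x div w = i}" "rank x = rank y"
      then show "x = y" using rank_strict[of x y] rank_strict[of y x] by (cases x y rule: linorder_cases) auto
    qed
    have "rank ` {x\<in>X. rank x div w = i} \<subseteq> {i * w..<i * w + w}"
    proof (rule image_subsetI)
      fix x assume "x \<in> {x\<in>X. rank x div w = i}"
      then show "rank x \<in> {i * w..<i * w + w}"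
        using w0 div_mult_mod_eq[of "rank x" w] mod_less_divisor[OF w0, of "rank x"] by auto
    qed
    from card_inj_on_le[OF inj this] have "card {x\<in>X. rank x div w = i} \<le> w" by simp
    then have "r * card {x\<in>X. rank x div w = i} \<le> r * w" by simp
    also have "\<dots> \<le> card X + r" by (simp add: w_def)
    finally show ?thesis using assms(3) by simp
  qed
qed

lemma card_same_block_pairs:
  assumes "finite X" and "\<And>i. r * card {x\<in>X. b x = i} \<le> k * card X"
  shows "r * card {(x, y). x \<in> X \<and> y \<in> X \<and> b x = b y} \<le> k * (card X)\<^sup>2"
proof -
  have "card {(x, y). x \<in> X \<and> y \<in> X \<and> b x = b y} = card (SIGMA x:X. {y\<in>X. b y = b x})"
    by (intro arg_cong[where f = card]) auto
  also have "\<dots> = (\<Sum>x\<in>X. card {y\<in>X. b y = b x})"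
    using assms(1) by (simp add: card_SigmaI)
  finally have "r * card {(x, y). x \<in> X \<and> y \<in> X \<and> b x = b y}
      = (\<Sum>x\<in>X. r * card {y\<in>X. b y = b x})" by (simp add: sum_distrib_left)
  also have "\<dots> \<le> (\<Sum>x\<in>X. k * card X)" by (intro sum_mono assms(2))
  finally show ?thesis by (simp add: power2_eq_square mult_ac)
qed

text \<open>A line of nonzero slope traverses the cells of the grid along a monotone staircase, so a cell
on it is determined by the sum (or difference) of its two indices.\<close>

lemma card_cells_on_line:
  fixes bX bY :: "real \<Rightarrow> nat" and a d :: real
  assumes "mono bX" "mono bY" "a \<noteq> 0" "finite Z"
    and "\<And>x. x \<in> Z \<Longrightarrow> bX x < r" "\<And>x. x \<in> Z \<Longrightarrow> bY (a * x - d) < r"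
  shows "card ((\<lambda>x. (bX x, bY (a * x - d))) ` Z) \<le> 2 * r"
proof -
  let ?c = "\<lambda>x. (bX x, bY (a * x - d))"
  \<comment> \<open>For negative slope the second index falls as \<open>x\<close> grows, so it is
    reversed. The truncated subtraction loses nothing, since second indices met on \<open>Z\<close>
    are below \<open>r\<close>.\<close>
  define h where "h = (\<lambda>(i, j). if a > 0 then i + j else i + (r - 1 - j))" 
  have key: "?c x = ?c y" if "x \<in> Z" "y \<in> Z" "h (?c x) = h (?c y)" "x \<le> y" for x y
  proof -
    have 1: "bX x \<le> bX y" using assms(1) that(4) by (auto dest: monoD)
    show ?thesis
    proof (cases "a > 0")
      case True
      have "bY (a * x - d) \<le> bY (a * y - d)"
        using True that(4) by (intro monoD[OF assms(2)]) simp
      with 1 True that(3) show ?thesis by (simp add: h_def)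
    next
      case False
      have "bY (a * y - d) \<le> bY (a * x - d)"
        using False that(4) by (intro monoD[OF assms(2)]) (simp add: mult_left_mono_neg)
      with 1 False that(3) assms(6)[OF that(1)] assms(6)[OF that(2)]
      show ?thesis by (simp add: h_def) arith
    qed
  qed
  have "inj_on h (?c ` Z)"
  proof (rule inj_onI)
    fix u v assume "u \<in> ?c ` Z" "v \<in> ?c ` Z" and e: "h u = h v"
    then obtain x y where "x \<in> Z" "y \<in> Z" "u = ?c x" "v = ?c y" by auto
    then show "u = v" using key[of x y] key[of y x] e by (cases "x \<le> y") auto
  qed
  moreover have "h ` ?c ` Z \<subseteq> {..<2 * r}"
    using assms(5,6) by (fastforce simp: h_def)
  ultimately show ?thesis
    by (metis card_inj_on_le card_lessThan finite_lessThan)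
qed

text \<open>The pair \<open>(a, d)\<close> stands for the line \<open>y = a * x - d\<close>, and
  \<open>I\<close> counts its incidences with \<open>X \<times> Y\<close>. The first alternative
  covers lines that carry boundedly many points on average, where no cell argument is
  possible.\<close>

lemma grid_incidence_bound:
  fixes X Y :: "real set" and L :: "(real \<times> real) set"
  assumes fin: "finite X" "finite Y" "finite L" and slope: "\<And>a d. (a, d) \<in> L \<Longrightarrow> a \<noteq> 0"
  defines "I \<equiv> card {((a, d), x). (a, d) \<in> L \<and> x \<in> X \<and> a * x - d \<in> Y}"
  shows "I \<le> 4 * card L \<or> I ^ 3 \<le> 128 * (card L)\<^sup>2 * (card X)\<^sup>2 * (card Y)\<^sup>2"
proof (cases "I \<le> 4 * card L")
  case False
  define Z where "Z l = {x\<in>X. fst l * x - snd l \<in> Y}" for l :: "real \<times> real"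
  have finZ: "finite (Z l)" for l using fin by (simp add: Z_def)
  have "{((a, d), x). (a, d) \<in> L \<and> x \<in> X \<and> a * x - d \<in> Y} = (SIGMA l:L. Z l)"
    by (auto simp: Z_def)
  then have I_sum: "I = (\<Sum>l\<in>L. card (Z l))"
    using fin finZ by (simp add: I_def card_SigmaI)
  have ZX: "card (Z l) \<le> card X" for l
    unfolding Z_def using fin by (intro card_mono) auto
  have ZY: "card (Z l) \<le> card Y" if "l \<in> L" for l
  proof (rule card_inj_on_le)
    show "inj_on (\<lambda>x. fst l * x - snd l) (Z l)"
      using slope[of "fst l" "snd l"] that by (auto intro: inj_onI)
  qed (use fin in \<open>auto simp: Z_def\<close>)
  have IX: "I \<le> card L * card X" and IY: "I \<le> card L * card Y"
    unfolding I_sum using sum_bounded_above[of L "\<lambda>l. card (Z l)"] ZX ZY by auto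
  have L0: "card L > 0" using False IX by (cases "card L = 0") auto
  \<comment> \<open>The largest \<open>r\<close> with \<open>4 * card L * r \<le> I\<close>: fine
    enough cells to make the count strong, yet few enough cells per line that pairs of equal points
    account for at most half of the final estimate.\<close>
  define r where "r = I div (4 * card L)"
  have r1: "1 \<le> r"
    using False L0 unfolding r_def by (metis One_nat_def Suc_leI div_greater_zero_iff nat_le_linear mult_pos_pos zero_less_numeral)
  have r_up: "4 * card L * r \<le> I" unfolding r_def by simp
  have r_low: "I \<le> 8 * card L * r"
  proof -
    have "I < 4 * card L * (r + 1)"
      using L0 unfolding r_def by (simp add: dividend_less_times_div)
    also have "\<dots> \<le> 4 * card L * (2 * r)" using r1 by (intro mult_left_mono) auto
    finally show ?thesis by simp
  qed
  have rX: "r \<le> card X" and rY: "r \<le> card Y"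
  proof -
    have "card L * r \<le> I" using r_up by simp
    with IX IY have "card L * r \<le> card L * card X" "card L * r \<le> card L * card Y" by linarith+
    with L0 show "r \<le> card X" "r \<le> card Y" by simp_all
  qed
  obtain bX where bX: "mono bX" "\<And>x. x \<in> X \<Longrightarrow> bX x < r"
      "\<And>i. r * card {x\<in>X. bX x = i} \<le> 2 * card X"
    using ex_block_decomposition[OF fin(1) r1 rX] by blast
  obtain bY where bY: "mono bY" "\<And>x. x \<in> Y \<Longrightarrow> bY x < r"
      "\<And>i. r * card {x\<in>Y. bY x = i} \<le> 2 * card Y"
    using ex_block_decomposition[OF fin(2) r1 rY] by blast
  define PX where "PX = {(x, y). x \<in> X \<and> y \<in> X \<and> bX x = bX y}"
  define PY where "PY = {(x, y). x \<in> Y \<and> y \<in> Y \<and> bY x = bY y}"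
  have finP: "finite PX" "finite PY"
    unfolding PX_def PY_def using fin
    by (auto intro: finite_subset[of _ "X \<times> X"] finite_subset[of _ "Y \<times> Y"])
  have cPX: "r * card PX \<le> 2 * (card X)\<^sup>2" and cPY: "r * card PY \<le> 2 * (card Y)\<^sup>2"
    unfolding PX_def PY_def using card_same_block_pairs[OF _ bX(3)] card_same_block_pairs[OF _ bY(3)] fin
    by auto
  define c where "c l x = (bX x, bY (fst l * x - snd l))" for l :: "real \<times> real" and x
  define Q where "Q l = {(x, y). x \<in> Z l \<and> y \<in> Z l \<and> x \<noteq> y \<and> c l x = c l y}" for l
  have finQ: "finite (Q l)" for l
    unfolding Q_def by (rule finite_subset[of _ "Z l \<times> Z l"]) (use finZ in auto)
  \<comment> \<open>Cauchy-Schwarz over the at most \<open>2 * r\<close> cells met by the line; the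
    collisions split into the diagonal and \<open>Q l\<close>.\<close>
  have line: "(card (Z l))\<^sup>2 \<le> 2 * r * (card (Z l) + card (Q l))" if "l \<in> L" for l
  proof -
    have "(card (Z l))\<^sup>2 \<le> card (c l ` Z l) * card {(x, y). x \<in> Z l \<and> y \<in> Z l \<and> c l x = c l y}"
      by (rule card_squared_le_collisions[OF finZ])
    also have "card (c l ` Z l) \<le> 2 * r"
      unfolding c_def
      by (rule card_cells_on_line[OF bX(1) bY(1)])
        (use slope[of "fst l" "snd l"] that finZ bX bY in \<open>auto simp: Z_def\<close>)
    also have "{(x, y). x \<in> Z l \<and> y \<in> Z l \<and> c l x = c l y} = (\<lambda>x. (x, x)) ` Z l \<union> Q l"
      by (auto simp: Q_def)
    also have "card \<dots> \<le> card (Z l) + card (Q l)"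
      using card_Un_le[of "(\<lambda>x. (x, x)) ` Z l" "Q l"] card_image_le[OF finZ, of "\<lambda>x. (x, x)" l]
      by linarith
    finally show ?thesis by (simp add: mult_left_mono mult_right_mono)
  qed
  text \<open>Two points with distinct abscissae lie on at most one common line.\<close>
  have Qsum: "(\<Sum>l\<in>L. card (Q l)) \<le> card PX * card PY"
  proof -
    have "(\<Sum>l\<in>L. card (Q l)) = card (SIGMA l:L. Q l)"
      using fin finQ by (simp add: card_SigmaI)
    also have "\<dots> \<le> card (PX \<times> PY)"
    proof (rule card_inj_on_le)
      let ?\<phi> = "\<lambda>(l, x, y). ((x, y), (fst l * x - snd l, fst l * y - snd l)) :: (real \<times> real) \<times> (real \<times> real)"
      show "inj_on ?\<phi> (SIGMA l:L. Q l)"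
      proof (rule inj_onI)
        fix u v assume uv: "u \<in> (SIGMA l:L. Q l)" "v \<in> (SIGMA l:L. Q l)" and e: "?\<phi> u = ?\<phi> v"
        obtain a d x y where u: "u = ((a, d), x, y)" by (metis prod.exhaust)
        obtain a' d' x' y' where v: "v = ((a', d'), x', y')" by (metis prod.exhaust)
        have xy: "x' = x" "y' = y" and ne: "x \<noteq> y" and "a * x - d = a' * x - d'" "a * y - d = a' * y - d'"
          using e uv by (auto simp: u v Q_def)
        then have "(a - a') * (x - y) = 0" by (simp add: algebra_simps)
        with ne have "a = a'" by simp
        moreover from this \<open>a * x - d = a' * x - d'\<close> have "d = d'" by simp
        ultimately show "u = v" by (simp add: u v xy)
      qed
      show "?\<phi> ` (SIGMA l:L. Q l) \<subseteq> PX \<times> PY"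
        by (auto simp: Q_def Z_def c_def PX_def PY_def)
    qed (use finP in simp)
    finally show ?thesis by (simp add: card_cartesian_product)
  qed
  \<comment> \<open>A second Cauchy-Schwarz, now over the lines.\<close>
  have "real I ^ 2 \<le> (\<Sum>l\<in>L. (real (card (Z l)))\<^sup>2) * card L"
    unfolding I_sum of_nat_sum by (rule sum_squared_le_sum_of_squares)
  then have "real (I ^ 2) \<le> real ((\<Sum>l\<in>L. (card (Z l))\<^sup>2) * card L)" by simp
  then have "I ^ 2 \<le> (\<Sum>l\<in>L. (card (Z l))\<^sup>2) * card L" by (simp only: of_nat_le_iff)
  also have "(\<Sum>l\<in>L. (card (Z l))\<^sup>2) \<le> (\<Sum>l\<in>L. 2 * r * (card (Z l) + card (Q l)))"
    by (intro sum_mono line)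
  also have "\<dots> = 2 * r * (I + (\<Sum>l\<in>L. card (Q l)))"
    by (simp add: I_sum sum_distrib_left sum.distrib algebra_simps)
  finally have "I ^ 2 \<le> 2 * r * (I + (\<Sum>l\<in>L. card (Q l))) * card L" by simp
  also have "\<dots> \<le> 2 * r * (I + card PX * card PY) * card L"
    using Qsum by simp
  finally have 1: "2 * I ^ 2 \<le> (4 * card L * r) * I + 4 * r * card PX * card PY * card L"
    by (simp add: algebra_simps)
  \<comment> \<open>The choice of \<open>r\<close> lets the diagonal term be absorbed into the
    left-hand side.\<close>
  have "(4 * card L * r) * I \<le> I\<^sup>2"
    using r_up by (simp add: power2_eq_square)
  with 1 have "I\<^sup>2 \<le> 4 * r * card PX * card PY * card L" by linarith
  \<comment> \<open>One more factor \<open>I \<le> 8 * card L * r\<close> supplies a second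
    \<open>r\<close>, so that \<open>card PX\<close> and \<open>card PY\<close> each have one to
    cancel.\<close>
  then have "I * I\<^sup>2 \<le> (8 * card L * r) * (4 * r * card PX * card PY * card L)"
    by (intro mult_mono r_low) auto
  also have "\<dots> = 32 * (card L)\<^sup>2 * ((r * card PX) * (r * card PY))"
    by (simp add: power2_eq_square)
  also have "\<dots> \<le> 32 * (card L)\<^sup>2 * ((2 * (card X)\<^sup>2) * (2 * (card Y)\<^sup>2))"
    by (intro mult_left_mono mult_mono cPX cPY) auto
  finally show ?thesis by (simp add: power3_eq_cube power2_eq_square mult_ac)
qed simp

text \<open>The \<open>L\<close> dyadic bands cover all nonzero values of \<open>h\<close>, and zero
  values carry no weight, so the heaviest band has at least a \<open>1 / L\<close> share. The weight
  is separate from \<open>h\<close> because both \<open>h\<close> and its square are needed.\<close>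

lemma dyadic_pigeonhole:
  fixes h :: "'a \<Rightarrow> nat" and w :: "'a \<Rightarrow> real"
  assumes "finite V" "\<And>v. v \<in> V \<Longrightarrow> h v < 2 ^ L"
    and "\<And>v. v \<in> V \<Longrightarrow> h v = 0 \<Longrightarrow> w v = 0" "\<And>v. v \<in> V \<Longrightarrow> 0 \<le> w v"
  obtains i where "(\<Sum>v\<in>V. w v) \<le> L * (\<Sum>v\<in>{v\<in>V. 2 ^ i \<le> h v \<and> h v < 2 ^ (i + 1)}. w v)"
proof -
  define band where "band i v \<longleftrightarrow> 2 ^ i \<le> h v \<and> h v < 2 ^ (i + 1)" for i :: nat and v
  define s where "s i = (\<Sum>v\<in>{v\<in>V. band i v}. w v)" for i
  have "(\<Sum>v\<in>V. w v) \<le> (\<Sum>v\<in>V. \<Sum>i<L. if band i v then w v else 0)"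
  proof (rule sum_mono)
    fix v assume v: "v \<in> V"
    show "w v \<le> (\<Sum>i<L. if band i v then w v else 0)"
    proof (cases "h v = 0")
      case True
      then show ?thesis using assms(3)[OF v] by (simp add: sum_nonneg)
    next
      case False
      then obtain i where i: "2 ^ i \<le> h v" "h v < 2 ^ (i + 1)"
        using ex_power_ivl1[of 2 "h v"] by auto
      then have "(2::nat) ^ i < 2 ^ L" using assms(2)[OF v] by linarith
      then have "i \<in> {..<L}" by simp
      then have "(if band i v then w v else 0) \<le> (\<Sum>i<L. if band i v then w v else 0)"
        by (rule member_le_sum) (use assms(4)[OF v] in auto)
      then show ?thesis using i by (simp add: band_def)
    qed
  qed
  also have "\<dots> = (\<Sum>i<L. s i)"
    unfolding s_def using assms(1) by (subst sum.swap) (simp add: sum.If_cases Int_def)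
  finally have le: "(\<Sum>v\<in>V. w v) \<le> (\<Sum>i<L. s i)" .
  have "\<exists>i. (\<Sum>v\<in>V. w v) \<le> L * s i"
  proof (rule ccontr)
    assume "\<not> ?thesis"
    then have less: "L * s i < (\<Sum>v\<in>V. w v)" for i by (simp add: not_le)
    have "L \<noteq> 0" using less[of 0] le by (cases "L = 0") auto
    then have "(\<Sum>i<L. L * s i) < (\<Sum>i<L. \<Sum>v\<in>V. w v)"
      by (intro sum_strict_mono less) auto
    with le \<open>L \<noteq> 0\<close> show False
      by (simp add: sum_distrib_left[symmetric])
  qed
  with that show ?thesis unfolding s_def band_def by blast
qed

section \<open>Energies as collision counts, and subadditivity of the additive energy\<close>

lemma additive_energy_eq_sum_collisions:
  "additive_energy X = card {(p, q). p \<in> X \<times> X \<and> q \<in> X \<times> X \<and> fst p + snd p = fst q + snd q}"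
  unfolding additive_energy_def
  by (rule bij_betw_same_card[OF bij_betw_byWitness[where f = "\<lambda>(x, y, z, w). ((x, y), (z, w))"
      and f' = "\<lambda>((x, y), (z, w)). (x, y, z, w)"]]) auto

lemma additive_energy_eq_diff_collisions:
  "additive_energy X = card {(p, q). p \<in> X \<times> X \<and> q \<in> X \<times> X \<and> fst p - snd p = fst q - snd q}"
  unfolding additive_energy_def
  by (rule bij_betw_same_card[OF bij_betw_byWitness[where f = "\<lambda>(x, y, z, w). ((x, z), (w, y))"
      and f' = "\<lambda>((x, z), (w, y)). (x, y, z, w)"]]) (auto simp: algebra_simps)

text \<open>Zero must be excluded: as \<open>x / 0 = 0\<close>, the quotients \<open>x / 0\<close>
  and \<open>0 / y\<close> would collide although \<open>x * y = 0 * 0\<close> fails for nonzero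
  \<open>x\<close> and \<open>y\<close>.\<close>

lemma multiplicative_energy_eq_ratio_collisions:
  assumes "0 \<notin> X"
  shows "multiplicative_energy X
    = card {(p, q). p \<in> X \<times> X \<and> q \<in> X \<times> X \<and> fst p / snd p = fst q / snd q}"
proof -
  have "x / z = w / y \<longleftrightarrow> x * y = z * w" if "x \<in> X" "y \<in> X" "z \<in> X" "w \<in> X" for x y z w
    using that assms by (subst frac_eq_eq) (auto simp: mult.commute)
  then show ?thesis
    unfolding multiplicative_energy_def
    by (intro bij_betw_same_card[OF bij_betw_byWitness[where f = "\<lambda>(x, y, z, w). ((x, z), (w, y))"
      and f' = "\<lambda>((x, z), (w, y)). (x, y, z, w)"]]) auto
qed

text \<open>Rewriting \<open>a + b = a' + b'\<close> as \<open>a - a' = b' - b\<close> separates the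
  two sets; Cauchy-Schwarz over the common difference then yields the two energies.\<close>

lemma sum_collisions_squared_le:
  assumes "finite A" "finite B"
  shows "(real (card {(p, q). p \<in> A \<times> B \<and> q \<in> A \<times> B \<and> fst p + snd p = fst q + snd q}))\<^sup>2
    \<le> real (additive_energy A) * real (additive_energy B)"
proof -
  define d :: "real \<times> real \<Rightarrow> real" where "d p = fst p - snd p" for p
  define V where "V = d ` (A \<times> A) \<union> d ` (B \<times> B)"
  have V: "finite V" using assms by (simp add: V_def)
  let ?r = "\<lambda>X v. real (card {p\<in>X \<times> X. d p = v})"
  have en: "(\<Sum>v\<in>V. (?r X v)\<^sup>2) = additive_energy X" if "X = A \<or> X = B" for X
  proof -
    have "additive_energy X = (\<Sum>v\<in>V. card {p\<in>X \<times> X. d p = v} * card {p\<in>X \<times> X. d p = v})"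
      unfolding additive_energy_eq_diff_collisions d_def[symmetric]
      by (rule card_collisions_eq_sum) (use assms that V in \<open>auto simp: V_def\<close>)
    then show ?thesis by (simp add: power2_eq_square)
  qed
  have "card {(p, q). p \<in> A \<times> B \<and> q \<in> A \<times> B \<and> fst p + snd p = fst q + snd q}
      = card {(p, q). p \<in> A \<times> A \<and> q \<in> B \<times> B \<and> d p = d q}"
    by (rule bij_betw_same_card[OF bij_betw_byWitness[where f = "\<lambda>((a, b), (a', b')). ((a, a'), (b', b))"
      and f' = "\<lambda>((a, a'), (b', b)). ((a, b), (a', b'))"]]) (auto simp: algebra_simps d_def)
  also have "\<dots> = (\<Sum>v\<in>V. card {p\<in>A \<times> A. d p = v} * card {p\<in>B \<times> B. d p = v})"
    by (rule card_collisions_eq_sum) (use assms V in \<open>auto simp: V_def\<close>)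
  finally have "real (card {(p, q). p \<in> A \<times> B \<and> q \<in> A \<times> B \<and> fst p + snd p = fst q + snd q})
      = (\<Sum>v\<in>V. ?r A v * ?r B v)" by simp
  then show ?thesis
    using Cauchy_Schwarz_ineq_sum[of "?r A" "?r B" V] by (simp add: en)
qed

text \<open>The fourth root of the additive energy is an $\ell^4$-norm (of a Fourier transform), hence
subadditive; the present form is what survives of the triangle inequality.\<close>

lemma additive_energy_union_le:
  fixes k :: real
  assumes fin: "finite A" "finite B" and disj: "A \<inter> B = {}" and k: "0 \<le> k"
    and A: "additive_energy A \<le> k * card A ^ 4" and B: "additive_energy B \<le> k * card B ^ 4"
  shows "additive_energy (A \<union> B) \<le> k * card (A \<union> B) ^ 4"
proof -
  define s :: "real \<times> real \<Rightarrow> real" where "s p = fst p + snd p" for p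
  let ?C = "A \<union> B"
  define V where "V = s ` (?C \<times> ?C)"
  have V: "finite V" using fin by (simp add: V_def)
  define r where "r X Y v = real (card {p\<in>X \<times> Y. s p = v})" for X Y v
  have norm: "(L2_set (r X Y) V)\<^sup>2 = card {(p, q). p \<in> X \<times> Y \<and> q \<in> X \<times> Y \<and> s p = s q}"
    if "X \<subseteq> ?C" "Y \<subseteq> ?C" for X Y
  proof -
    have "finite X" "finite Y" using that fin finite_subset by blast+
    then have "card {(p, q). p \<in> X \<times> Y \<and> q \<in> X \<times> Y \<and> s p = s q}
        = (\<Sum>v\<in>V. card {p\<in>X \<times> Y. s p = v} * card {p\<in>X \<times> Y. s p = v})"
      by (intro card_collisions_eq_sum) (use that V in \<open>auto simp: V_def\<close>)
    then show ?thesis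
      by (simp add: L2_set_def r_def sum_nonneg power2_eq_square)
  qed
  have norm_energy: "(L2_set (r X X) V)\<^sup>2 = additive_energy X" if "X \<subseteq> ?C" for X
    using norm[OF that that] by (simp add: additive_energy_eq_sum_collisions s_def)
  define \<kappa> where "\<kappa> = sqrt k"
  have \<kappa>: "0 \<le> \<kappa>" "\<kappa>\<^sup>2 = k" using k by (auto simp: \<kappa>_def)
  have NA: "L2_set (r A A) V \<le> \<kappa> * (card A)\<^sup>2"
    by (rule power2_le_imp_le) (use A \<kappa> in \<open>auto simp: norm_energy power_mult_distrib\<close>)
  have NB: "L2_set (r B B) V \<le> \<kappa> * (card B)\<^sup>2"
    by (rule power2_le_imp_le) (use B \<kappa> in \<open>auto simp: norm_energy power_mult_distrib\<close>)
  have NAB: "L2_set (r A B) V \<le> \<kappa> * (card A * card B)"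
  \<comment> \<open>The mixed bound controls the fourth power of the norm, hence two square
    roots.\<close>
  proof (rule power2_le_imp_le, rule power2_le_imp_le)
    have "((L2_set (r A B) V)\<^sup>2)\<^sup>2 \<le> real (additive_energy A) * real (additive_energy B)"
      using sum_collisions_squared_le[OF fin] by (simp add: norm s_def)
    also have "\<dots> \<le> (k * card A ^ 4) * (k * card B ^ 4)"
      by (intro mult_mono A B) (use k in auto)
    also have "\<dots> = ((\<kappa> * (card A * card B))\<^sup>2)\<^sup>2"
      unfolding \<kappa>(2)[symmetric] by (simp add: algebra_simps power_mult_distrib power_mult[symmetric])
    finally show "((L2_set (r A B) V)\<^sup>2)\<^sup>2 \<le> ((\<kappa> * (card A * card B))\<^sup>2)\<^sup>2" .
  qed (use \<kappa> in auto)
  have r_Un: "r ?C Y v = r A Y v + r B Y v" if "finite Y" for Y v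
  proof -
    have "{p\<in>?C \<times> Y. s p = v} = {p\<in>A \<times> Y. s p = v} \<union> {p\<in>B \<times> Y. s p = v}" by auto
    moreover have "{p\<in>A \<times> Y. s p = v} \<inter> {p\<in>B \<times> Y. s p = v} = {}" using disj by blast
    ultimately show ?thesis using fin that by (simp add: r_def card_Un_disjoint)
  qed
  have r_swap: "r X Y v = r Y X v" for X Y v
  proof -
    have "card {p\<in>X \<times> Y. s p = v} = card {p\<in>Y \<times> X. s p = v}"
      by (rule bij_betw_same_card[OF bij_betw_byWitness[where f = prod.swap and f' = prod.swap]])
        (auto simp: s_def add.commute)
    then show ?thesis by (simp add: r_def)
  qed
  \<comment> \<open>The cross term appears twice, matching the expansion of
    \<open>(card A + card B)\<^sup>2\<close> to which the triangle inequality leads.\<close>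
  have split: "r ?C ?C = (\<lambda>v. r A A v + (r A B v + r A B v) + r B B v)"
  proof
    fix v
    show "r ?C ?C v = r A A v + (r A B v + r A B v) + r B B v"
      using r_Un[of ?C v] r_Un[of A v] r_Un[of B v] r_swap[of A ?C v] r_swap[of B ?C v]
        r_swap[of B A v] fin by simp
  qed
  have "L2_set (r ?C ?C) V \<le> L2_set (r A A) V + (L2_set (r A B) V + L2_set (r A B) V) + L2_set (r B B) V"
    unfolding split
    by (intro order_trans[OF L2_set_triangle_ineq] add_mono order_refl)
  also have "\<dots> \<le> \<kappa> * (card A)\<^sup>2 + (\<kappa> * (card A * card B) + \<kappa> * (card A * card B)) + \<kappa> * (card B)\<^sup>2"
    by (intro add_mono NA NB NAB)
  also have "\<dots> = \<kappa> * (card ?C)\<^sup>2"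
    using fin disj by (simp add: card_Un_disjoint power2_sum algebra_simps)
  finally have "(L2_set (r ?C ?C) V)\<^sup>2 \<le> (\<kappa> * (card ?C)\<^sup>2)\<^sup>2"
    by (intro power_mono) auto
  then show ?thesis by (simp add: norm_energy power_mult_distrib \<kappa>(2))
qed

section \<open>A subset of small additive energy\<close>

text \<open>The elimination of parameters for the next lemma. There \<open>S\<close> counts the
  popular ratios, each with about \<open>\<tau>\<close> representations; \<open>a\<close> is the
  size of the subset, whose elements each have about \<open>q\<close> representations;
  \<open>D\<close> counts its popular differences, each with about \<open>t\<close> representations.
  Thus \<open>D * t\<^sup>2\<close> is the additive energy up to logarithms.\<close>

lemma energy_parameter_inequality:
  fixes S \<tau> q a n L M D t :: real
  assumes pos: "0 < S" "0 < a" "1 \<le> n" "0 \<le> L" "0 < M" "0 < \<tau>" "0 < q" "0 < t" "0 \<le> D"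
    and M: "M \<le> 4 * L * \<tau>\<^sup>2 * S" and \<tau>S: "\<tau> * S \<le> 2 * L * q * a"
    and q: "q \<le> n" "q \<le> S" and tD: "t * D \<le> a\<^sup>2"
    and inc: "D * t * q \<le> 4 * (n * D) \<or> (D * t * q) ^ 3 \<le> 128 * (n * D)\<^sup>2 * S\<^sup>2 * a\<^sup>2"
  shows "D * t\<^sup>2 * M \<le> 256 * L ^ 3 * a ^ 4 * (n * sqrt n)"
proof (cases "D = 0")
  case False
  then have D: "0 < D" using pos by simp
  from inc show ?thesis
  proof
    assume "D * t * q \<le> 4 * (n * D)"
    then have "D * (t * q) \<le> D * (4 * n)" by (simp add: mult_ac)
    then have tq: "t * q \<le> 4 * n" using D by simp
    have "\<tau> * S \<le> (2 * L * a) * q" using \<tau>S by (simp add: mult_ac)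
    also have "\<dots> \<le> (2 * L * a) * S" by (intro mult_left_mono q(2)) (use pos in auto)
    finally have "\<tau> * S \<le> (2 * L * a) * S" .
    then have \<tau>: "\<tau> \<le> 2 * L * a" using pos by simp
    have "M \<le> 4 * L * (\<tau> * (\<tau> * S))" using M by (simp add: power2_eq_square mult_ac)
    also have "\<dots> \<le> 4 * L * ((2 * L * a) * (2 * L * q * a))"
      by (intro mult_left_mono mult_mono \<tau> \<tau>S) (use pos in auto)
    finally have M': "M \<le> 16 * L ^ 3 * q * a\<^sup>2"
      by (simp add: power2_eq_square power3_eq_cube mult_ac)
    \<comment> \<open>The extra \<open>q\<close> pairs with \<open>t\<close> to use
      \<open>tq\<close>, and cancels against the \<open>q\<close> in \<open>M'\<close>.\<close>
    have "(D * t\<^sup>2 * M) * q = ((t * D) * (t * q)) * M"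
      by (simp add: power2_eq_square mult_ac)
    also have "\<dots> \<le> (a\<^sup>2 * (4 * n)) * (16 * L ^ 3 * q * a\<^sup>2)"
      by (intro mult_mono tD tq M') (use pos in auto)
    also have "\<dots> = (64 * L ^ 3 * a ^ 4 * (n * 1)) * q" by (simp add: power2_eq_square power4_eq_xxxx mult_ac)
    finally have "D * t\<^sup>2 * M \<le> 64 * L ^ 3 * a ^ 4 * (n * 1)" using pos by simp
    also have "\<dots> \<le> 256 * L ^ 3 * a ^ 4 * (n * sqrt n)"
      by (intro mult_mono) (use pos in auto)
    finally show ?thesis .
  next
    assume "(D * t * q) ^ 3 \<le> 128 * (n * D)\<^sup>2 * S\<^sup>2 * a\<^sup>2"
    then have "D\<^sup>2 * (D * t ^ 3 * q ^ 3) \<le> D\<^sup>2 * (128 * n\<^sup>2 * S\<^sup>2 * a\<^sup>2)"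
      by (simp add: power_mult_distrib power2_eq_square power3_eq_cube mult_ac)
    then have 1: "D * t ^ 3 * q ^ 3 \<le> 128 * n\<^sup>2 * S\<^sup>2 * a\<^sup>2" using D by simp
    \<comment> \<open>Squaring makes the powers fit: \<open>S\<^sup>2\<close> from the incidence
      bound and \<open>\<tau> ^ 4 * S\<^sup>2\<close> from \<open>M\<^sup>2\<close> combine to
      \<open>(\<tau> * S) ^ 4\<close>, which is bounded through \<open>\<tau>S\<close>.\<close>
    have "(D * t\<^sup>2 * M)\<^sup>2 * q ^ 3 = (D * t ^ 3 * q ^ 3) * (t * D) * M\<^sup>2"
      by (simp add: power2_eq_square power3_eq_cube mult_ac)
    also have "\<dots> \<le> (128 * n\<^sup>2 * S\<^sup>2 * a\<^sup>2) * a\<^sup>2 * (4 * L * \<tau>\<^sup>2 * S)\<^sup>2"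
      by (intro mult_mono 1 tD power_mono M) (use pos in auto)
    also have "\<dots> = 2048 * L\<^sup>2 * n\<^sup>2 * a ^ 4 * (\<tau> * S) ^ 4"
      by (simp add: power2_eq_square power4_eq_xxxx mult_ac)
    also have "\<dots> \<le> 2048 * L\<^sup>2 * n\<^sup>2 * a ^ 4 * (2 * L * q * a) ^ 4"
      by (intro mult_left_mono power_mono \<tau>S) (use pos in auto)
    also have "\<dots> = (32768 * (L ^ 3)\<^sup>2 * (a ^ 4)\<^sup>2 * n\<^sup>2 * q) * q ^ 3"
      by (simp add: power2_eq_square power3_eq_cube power4_eq_xxxx mult_ac)
    finally have "(D * t\<^sup>2 * M)\<^sup>2 \<le> 32768 * (L ^ 3)\<^sup>2 * (a ^ 4)\<^sup>2 * n\<^sup>2 * q" using pos by simp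
    \<comment> \<open>The constant is rounded up to the square of 256, and \<open>q \<le> n\<close>
      leaves \<open>n ^ 3\<close>, the square of \<open>n * sqrt n\<close>.\<close>
    also have "\<dots> \<le> 65536 * (L ^ 3)\<^sup>2 * (a ^ 4)\<^sup>2 * n\<^sup>2 * n"
      by (intro mult_mono q) (use pos in auto)
    also have "\<dots> = (256 * L ^ 3 * a ^ 4 * (n * sqrt n))\<^sup>2"
      using pos by (simp add: power_mult_distrib)
    finally show ?thesis by (rule power2_le_imp_le) (use pos in auto)
  qed
qed (use pos in auto)

text \<open>A popular dyadic level $S$ of ratios is chosen first, then the set $A'$ of elements with
equally many representations $x = as$ with $a \in A$, $s \in S$. A popular difference $d$ of $A'$
gives many incidences $y = as - d$ between the points $S \times A'$ and the lines with
parameters $(a, d)$, so the incidence bound limits the number of such differences.\<close>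

lemma ex_subset_small_additive_energy:
  fixes A :: "real set" and n L :: nat and M :: real
  assumes A: "finite A" "0 \<notin> A" "card A \<le> n" and L: "n < 2 ^ L"
    and M: "0 < M" "M \<le> multiplicative_energy A"
  obtains A' where "A' \<subseteq> A" "A' \<noteq> {}"
    "additive_energy A' \<le> 1024 * real L ^ 4 * (n * sqrt n) / M * card A' ^ 4"
proof -
  define f :: "real \<times> real \<Rightarrow> real" where "f p = fst p / snd p" for p
  define V where "V = f ` (A \<times> A)"
  define h where "h v = card {p\<in>A \<times> A. f p = v}" for v
  have V: "finite V" using A by (simp add: V_def)
  have V0: "v \<noteq> 0" if "v \<in> V" for v using that A by (auto simp: V_def f_def)
  have h_eq: "h v = card {x\<in>A. x / v \<in> A}" if "v \<noteq> 0" for v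
    unfolding h_def
    by (rule bij_betw_same_card[OF bij_betw_byWitness[where f = fst and f' = "\<lambda>x. (x, x / v)"]])
      (use that A in \<open>auto simp: f_def\<close>)
  have h_less: "h v < 2 ^ L" if "v \<in> V" for v
  proof -
    have "h v \<le> card A"
      unfolding h_eq[OF V0[OF that]] using A by (intro card_mono) auto
    then show ?thesis using A L by linarith
  qed
  have "multiplicative_energy A = (\<Sum>v\<in>V. h v * h v)"
    unfolding multiplicative_energy_eq_ratio_collisions[OF A(2)] f_def[symmetric] h_def
    by (rule card_collisions_eq_sum) (use A V in \<open>auto simp: V_def\<close>)
  then have mult: "real (multiplicative_energy A) = (\<Sum>v\<in>V. (real (h v))\<^sup>2)"
    by (simp add: power2_eq_square)
  obtain i where i: "(\<Sum>v\<in>V. (real (h v))\<^sup>2)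
      \<le> L * (\<Sum>v\<in>{v\<in>V. 2 ^ i \<le> h v \<and> h v < 2 ^ (i + 1)}. (real (h v))\<^sup>2)"
    by (rule dyadic_pigeonhole[OF V, of h L "\<lambda>v. (real (h v))\<^sup>2"]) (use h_less in auto)
  define S where "S = {v\<in>V. 2 ^ i \<le> h v \<and> h v < 2 ^ (i + 1)}"
  define \<tau> where "\<tau> = (2::nat) ^ i"
  have S: "finite S" "S \<subseteq> V" using V by (auto simp: S_def)
  have "M \<le> L * (\<Sum>v\<in>S. (real (h v))\<^sup>2)" using M i mult by (simp add: S_def)
  also have "\<dots> \<le> L * (\<Sum>v\<in>S. (real (2 * \<tau>))\<^sup>2)"
    by (intro mult_left_mono sum_mono power_mono of_nat_mono) (auto simp: S_def \<tau>_def)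
  also have "\<dots> = 4 * real L * (real \<tau>)\<^sup>2 * card S" by (simp add: power_mult_distrib)
  finally have M_le: "M \<le> 4 * real L * (real \<tau>)\<^sup>2 * card S" .
  have S_pos: "0 < card S" using M_le M by (cases "card S = 0") auto

  define g where "g x = card {s\<in>S. x / s \<in> A}" for x
  have gS: "g x \<le> card S" for x
    unfolding g_def using S by (intro card_mono) auto
  have gn: "g x \<le> card A" if "x \<in> A" for x
    unfolding g_def
  proof (rule card_inj_on_le)
    show "inj_on (\<lambda>s. x / s) {s\<in>S. x / s \<in> A}"
    proof (rule inj_onI)
      fix s s' assume "s \<in> {s\<in>S. x / s \<in> A}" "s' \<in> {s\<in>S. x / s \<in> A}" "x / s = x / s'"
      moreover have "x \<noteq> 0" using that A by auto
      ultimately show "s = s'" using V0 S by auto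
    qed
  qed (use A in auto)
  \<comment> \<open>Double counting of the pairs \<open>(x, s)\<close> with \<open>s \<in> S\<close>
    and both \<open>x\<close> and \<open>x / s\<close> in \<open>A\<close>.\<close>
  have "(\<Sum>x\<in>A. g x) = (\<Sum>s\<in>S. h s)"
    unfolding g_def
    by (rule sum_multicount_gen) (use A S V0 h_eq in auto)
  moreover have "\<tau> * card S \<le> (\<Sum>s\<in>S. h s)"
    using sum_bounded_below[of S \<tau> h] by (simp add: S_def \<tau>_def mult.commute)
  ultimately have "\<tau> * card S \<le> (\<Sum>x\<in>A. g x)" by simp
  then have "real (\<tau> * card S) \<le> real (\<Sum>x\<in>A. g x)" by (simp only: of_nat_le_iff)
  then have \<tau>S: "real \<tau> * card S \<le> (\<Sum>x\<in>A. real (g x))" by simp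
  have g_less: "g x < 2 ^ L" if "x \<in> A" for x using gn[OF that] A L by linarith
  obtain j where j: "(\<Sum>x\<in>A. real (g x))
      \<le> L * (\<Sum>x\<in>{x\<in>A. 2 ^ j \<le> g x \<and> g x < 2 ^ (j + 1)}. real (g x))"
    by (rule dyadic_pigeonhole[OF A(1), of g L "\<lambda>x. real (g x)"])
      (use g_less in auto)
  define A' where "A' = {x\<in>A. 2 ^ j \<le> g x \<and> g x < 2 ^ (j + 1)}"
  define q where "q = (2::nat) ^ j"
  have A': "finite A'" "A' \<subseteq> A" using A by (auto simp: A'_def)
  have "real \<tau> * card S \<le> L * (\<Sum>x\<in>A'. real (g x))" using \<tau>S j by (simp add: A'_def)
  also have "\<dots> \<le> L * (\<Sum>x\<in>A'. real (2 * q))"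
    by (intro mult_left_mono sum_mono of_nat_mono) (auto simp: A'_def q_def)
  also have "\<dots> = 2 * real L * q * card A'" by simp
  finally have \<tau>S_le: "real \<tau> * card S \<le> 2 * real L * q * card A'" .
  have A'_pos: "0 < card A'"
  proof -
    have "0 < real \<tau> * card S" using S_pos by (simp add: \<tau>_def)
    then show ?thesis using \<tau>S_le by (cases "card A' = 0") auto
  qed
  \<comment> \<open>Any one element of \<open>A'\<close> witnesses both upper bounds on
    \<open>q\<close>.\<close>
  then obtain x0 where x0: "x0 \<in> A'" by (metis card_gt_0_iff ex_in_conv)
  have "q \<le> g x0" using x0 by (simp add: A'_def q_def)
  then have qn: "q \<le> n" and qS: "q \<le> card S"
    using gn[of x0] gS[of x0] x0 A' A by auto

  define e :: "real \<times> real \<Rightarrow> real" where "e p = fst p - snd p" for p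
  define W where "W = e ` (A' \<times> A')"
  define \<rho> where "\<rho> d = card {p\<in>A' \<times> A'. e p = d}" for d
  have W: "finite W" using A' by (simp add: W_def)
  have \<rho>_less: "\<rho> d < 2 ^ L" for d
  proof -
    have "\<rho> d \<le> card A"
      unfolding \<rho>_def
    proof (rule card_inj_on_le)
      show "inj_on fst {p\<in>A' \<times> A'. e p = d}"
        by (auto intro!: inj_onI simp: e_def)
    qed (use A A' in auto)
    then show ?thesis using A L by linarith
  qed
  have "additive_energy A' = (\<Sum>d\<in>W. \<rho> d * \<rho> d)"
    unfolding additive_energy_eq_diff_collisions e_def[symmetric] \<rho>_def
    by (rule card_collisions_eq_sum) (use A' W in \<open>auto simp: W_def\<close>)
  then have add: "real (additive_energy A') = (\<Sum>d\<in>W. (real (\<rho> d))\<^sup>2)"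
    by (simp add: power2_eq_square)
  obtain k where k: "(\<Sum>d\<in>W. (real (\<rho> d))\<^sup>2)
      \<le> L * (\<Sum>d\<in>{d\<in>W. 2 ^ k \<le> \<rho> d \<and> \<rho> d < 2 ^ (k + 1)}. (real (\<rho> d))\<^sup>2)"
    by (rule dyadic_pigeonhole[OF W, of \<rho> L "\<lambda>v. (real (\<rho> v))\<^sup>2"]) (use \<rho>_less in auto)
  define D where "D = {d\<in>W. 2 ^ k \<le> \<rho> d \<and> \<rho> d < 2 ^ (k + 1)}"
  define t where "t = (2::nat) ^ k"
  have D: "finite D" "D \<subseteq> W" using W by (auto simp: D_def)
  have "additive_energy A' \<le> L * (\<Sum>d\<in>D. (real (\<rho> d))\<^sup>2)" using k add by (simp add: D_def)
  also have "\<dots> \<le> L * (\<Sum>d\<in>D. (real (2 * t))\<^sup>2)"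
    by (intro mult_left_mono sum_mono power_mono of_nat_mono) (auto simp: D_def t_def)
  also have "\<dots> = 4 * real L * (card D * (real t)\<^sup>2)" by (simp add: power_mult_distrib)
  finally have E_le: "additive_energy A' \<le> 4 * real L * (card D * (real t)\<^sup>2)" .
  \<comment> \<open>Each popular difference uses at least \<open>t\<close> of the pairs from
    \<open>A' \<times> A'\<close>.\<close>
  have "t * card D \<le> (\<Sum>d\<in>D. \<rho> d)"
    using sum_bounded_below[of D t \<rho>] by (simp add: D_def t_def mult.commute)
  also have "\<dots> \<le> (\<Sum>d\<in>W. \<rho> d)" by (rule sum_mono2) (use W D in auto)
  also have "\<dots> = card (A' \<times> A')"
    unfolding \<rho>_def by (rule card_eq_sum_fibres[symmetric]) (use A' W in \<open>auto simp: W_def\<close>)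
  finally have tD: "t * card D \<le> (card A')\<^sup>2" by (simp add: card_cartesian_product power2_eq_square)

  define I where "I = card {((a, d), s). (a, d) \<in> A \<times> D \<and> s \<in> S \<and> a * s - d \<in> A'}"
  have "card D * t * q \<le> I"
  proof -
    \<comment> \<open>A difference \<open>d = x - y\<close> within \<open>A'\<close> and a
      representation \<open>x = a * s\<close> give \<open>a * s - d = y\<close>: the point
      \<open>(s, y)\<close> lies on the line \<open>(a, d)\<close>. There are at least
      \<open>t\<close> choices of \<open>(x, y)\<close> for each \<open>d\<close>, and at least
      \<open>q\<close> of \<open>s\<close> for each \<open>x\<close>.\<close>
    define T where "T = (SIGMA d:D. SIGMA p:{p\<in>A' \<times> A'. e p = d}. {s\<in>S. fst p / s \<in> A})"
    have "card D * (t * q) \<le> (\<Sum>d\<in>D. \<Sum>p\<in>{p\<in>A' \<times> A'. e p = d}. g (fst p))"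
    proof -
      have "t * q \<le> (\<Sum>p\<in>{p\<in>A' \<times> A'. e p = d}. g (fst p))" if "d \<in> D" for d
      proof -
        have "t * q \<le> \<rho> d * q" using that by (simp add: D_def t_def)
        also have "\<dots> \<le> (\<Sum>p\<in>{p\<in>A' \<times> A'. e p = d}. g (fst p))"
          unfolding \<rho>_def
          using sum_bounded_below[of "{p\<in>A' \<times> A'. e p = d}" q "\<lambda>p. g (fst p)"]
          by (auto simp: A'_def q_def)
        finally show ?thesis .
      qed
      then show ?thesis
        using sum_bounded_below[of D "t * q" "\<lambda>d. \<Sum>p\<in>{p\<in>A' \<times> A'. e p = d}. g (fst p)"]
        by simp
    qed
    also have "\<dots> = card T"
    proof -
      have "finite (SIGMA p:{p\<in>A' \<times> A'. e p = d}. {s\<in>S. fst p / s \<in> A})" for d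
        using A' S by (intro finite_SigmaI) auto
      then show ?thesis
        unfolding T_def g_def using D S A' by (simp add: card_SigmaI)
    qed
    also have "\<dots> \<le> I"
      unfolding I_def
    proof (rule card_inj_on_le)
      let ?\<phi> = "\<lambda>(d, p, s). ((fst p / s, d), s) :: (real \<times> real) \<times> real"
      have S0: "s \<noteq> 0" if "s \<in> S" for s using that S V0 by auto
      show "inj_on ?\<phi> T"
      proof (rule inj_onI)
        fix u v assume uv: "u \<in> T" "v \<in> T" "?\<phi> u = ?\<phi> v"
        obtain d x y s where u: "u = (d, (x, y), s)" by (metis prod.exhaust)
        obtain d' x' y' s' where v: "v = (d', (x', y'), s')" by (metis prod.exhaust)
        have 1: "d' = d" "s' = s" "x / s = x' / s" "s \<in> S" "x - y = d" "x' - y' = d"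
          using uv by (auto simp: u v T_def e_def)
        then have "x = x'" using S0[of s] by simp
        with 1 show "u = v" by (simp add: u v)
      qed
      show "?\<phi> ` T \<subseteq> {((a, d), s). (a, d) \<in> A \<times> D \<and> s \<in> S \<and> a * s - d \<in> A'}"
        using S0 by (auto simp: T_def e_def)
      show "finite {((a, d), s). (a, d) \<in> A \<times> D \<and> s \<in> S \<and> a * s - d \<in> A'}"
        by (rule finite_subset[of _ "(A \<times> D) \<times> S"]) (use A D S in auto)
    qed
    finally show ?thesis by (simp add: mult.assoc)
  qed
  moreover have "I \<le> 4 * card (A \<times> D) \<or> I ^ 3 \<le> 128 * (card (A \<times> D))\<^sup>2 * (card S)\<^sup>2 * (card A')\<^sup>2"
    unfolding I_def by (rule grid_incidence_bound) (use A S D A' in auto)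
  moreover have AD: "card (A \<times> D) \<le> n * card D"
    using A by (simp add: card_cartesian_product)
  ultimately have "card D * t * q \<le> 4 * (n * card D)
      \<or> (card D * t * q) ^ 3 \<le> 128 * (n * card D)\<^sup>2 * (card S)\<^sup>2 * (card A')\<^sup>2"
  proof (elim disjE)
    assume 1: "card D * t * q \<le> I" and "I \<le> 4 * card (A \<times> D)"
    with AD show ?thesis by linarith
  next
    assume 1: "card D * t * q \<le> I"
      and 2: "I ^ 3 \<le> 128 * (card (A \<times> D))\<^sup>2 * (card S)\<^sup>2 * (card A')\<^sup>2"
    have "(card D * t * q) ^ 3 \<le> I ^ 3" using 1 by (intro power_mono) auto
    also note 2
    also have "128 * (card (A \<times> D))\<^sup>2 * (card S)\<^sup>2 * (card A')\<^sup>2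
        \<le> 128 * (n * card D)\<^sup>2 * (card S)\<^sup>2 * (card A')\<^sup>2"
      by (intro mult_mono power_mono AD) auto
    finally show ?thesis ..
  qed
  then have "real (card D * t * q) \<le> real (4 * (n * card D))
      \<or> real ((card D * t * q) ^ 3) \<le> real (128 * (n * card D)\<^sup>2 * (card S)\<^sup>2 * (card A')\<^sup>2)"
    by (simp only: of_nat_le_iff)
  then have inc: "real (card D) * t * q \<le> 4 * (real n * card D)
      \<or> (real (card D) * t * q) ^ 3 \<le> 128 * (real n * card D)\<^sup>2 * (real (card S))\<^sup>2 * (real (card A'))\<^sup>2"
    by simp
  have "real (t * card D) \<le> real ((card A')\<^sup>2)" using tD by (simp only: of_nat_le_iff)
  then have tD': "real t * card D \<le> (real (card A'))\<^sup>2" by simp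
  have pos: "0 < \<tau>" "0 < q" "0 < t" by (simp_all add: \<tau>_def q_def t_def)
  have "card D * (real t)\<^sup>2 * M \<le> 256 * real L ^ 3 * real (card A') ^ 4 * (n * sqrt n)"
    by (rule energy_parameter_inequality[OF _ _ _ _ M(1) _ _ _ _ M_le \<tau>S_le _ _ tD' inc])
      (use pos S_pos A'_pos qn qS in auto)
  then have DtM: "card D * (real t)\<^sup>2 \<le> 256 * real L ^ 3 * real (card A') ^ 4 * (n * sqrt n) / M"
    using M by (simp add: pos_le_divide_eq)
  have "additive_energy A' \<le> 4 * real L * (256 * real L ^ 3 * real (card A') ^ 4 * (n * sqrt n) / M)"
    by (rule order_trans[OF E_le]) (intro mult_left_mono DtM, simp)
  also have "\<dots> = 1024 * real L ^ 4 * (n * sqrt n) / M * card A' ^ 4"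
    by (simp add: power4_eq_xxxx power3_eq_cube)
  finally show ?thesis using that A' A'_pos by force
qed

section \<open>The decomposition and the choice of threshold\<close>

text \<open>If the common product vanishes, each side has a zero factor: four choices of positions,
  each leaving two free entries.\<close>

lemma multiplicative_energy_remove_zero:
  assumes "finite X"
  shows "multiplicative_energy X \<le> multiplicative_energy (X - {0}) + 4 * (card X)\<^sup>2"
proof -
  let ?E = "\<lambda>X. {(x1, x2, x3, x4). x1 \<in> X \<and> x2 \<in> X \<and> x3 \<in> X \<and> x4 \<in> X \<and> x1 * x2 = x3 * (x4::real)}"
  let ?f = "\<lambda>(x, y). (0, x, 0, y)" and ?g = "\<lambda>(x, y). (0, x, y, 0)"
    and ?h = "\<lambda>(x, y). (x, 0, 0, y)" and ?k = "\<lambda>(x, y). (x, 0, y, 0)"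
  let ?Z = "(?f ` (X \<times> X) \<union> ?g ` (X \<times> X)) \<union> (?h ` (X \<times> X) \<union> ?k ` (X \<times> X))"
  have fin: "finite (?E Y)" if "Y \<subseteq> X" for Y
    by (rule finite_subset[of _ "X \<times> X \<times> X \<times> X"]) (use that assms in auto)
  have "?E X \<subseteq> ?E (X - {0}) \<union> ?Z"
  proof
    fix u assume u: "u \<in> ?E X"
    obtain x y z w where uv: "u = (x, y, z, w)" by (metis prod.exhaust)
    have X: "x \<in> X" "y \<in> X" "z \<in> X" "w \<in> X" and eq: "x * y = z * w" using u by (auto simp: uv)
    show "u \<in> ?E (X - {0}) \<union> ?Z"
    proof (cases "x * y = 0")
      case True
      then have "x = 0 \<or> y = 0" "z = 0 \<or> w = 0" using eq by auto
      then show ?thesis using X by (auto simp: uv image_iff)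
    next
      case False
      then show ?thesis using X eq by (auto simp: uv)
    qed
  qed
  moreover have "finite (?E (X - {0}) \<union> ?Z)"
    using fin[of "X - {0}"] assms by (intro finite_UnI finite_imageI) blast+
  ultimately have "card (?E X) \<le> card (?E (X - {0}) \<union> ?Z)" by (intro card_mono)
  also have "\<dots> \<le> card (?E (X - {0})) + card ?Z" by (rule card_Un_le)
  also have "card ?Z \<le> (card (X \<times> X) + card (X \<times> X)) + (card (X \<times> X) + card (X \<times> X))"
    by (intro order_trans[OF card_Un_le] add_mono card_image_le) (use assms in auto)
  finally show ?thesis
    by (simp add: multiplicative_energy_def card_cartesian_product power2_eq_square)
qed

lemma additive_energy_decomposition:
  fixes A :: "real set" and L :: nat and M :: real
  assumes "finite A" "card A < 2 ^ L" "0 < M"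
  obtains B C where "A = B \<union> C" "B \<inter> C = {}"
    "additive_energy B \<le> 1024 * real L ^ 4 * (card A * sqrt (card A)) / M * card A ^ 4"
    "multiplicative_energy C \<le> M + 4 * (real (card A))\<^sup>2"
proof -
  define k where "k = 1024 * real L ^ 4 * (card A * sqrt (card A)) / M"
  have k0: "0 \<le> k" using assms by (simp add: k_def)
  \<comment> \<open>Zero is barred from \<open>B\<close>, so it ends up in \<open>C\<close> if it
    lies in \<open>A\<close>, at a quadratic cost. The bound is relative to
    \<open>card B ^ 4\<close> because that form survives disjoint unions.\<close>
  define F where "F = {B. B \<subseteq> A - {0} \<and> additive_energy B \<le> k * card B ^ 4}"
  have "finite F" using assms by (auto simp: F_def intro: finite_subset[of _ "Pow A"])
  moreover have "{} \<in> F" by (simp add: F_def additive_energy_def)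
  ultimately obtain B where B: "B \<in> F" and max: "\<And>B'. B' \<in> F \<Longrightarrow> B \<subseteq> B' \<Longrightarrow> B = B'"
    using finite_has_maximal[of F] by blast
  have BA: "B \<subseteq> A - {0}" "finite B" using B assms finite_subset by (auto simp: F_def)
  define C where "C = A - B"
  have mono: "card X \<le> card A" if "X \<subseteq> A" for X using that assms by (simp add: card_mono)
  have small: "multiplicative_energy (C - {0}) \<le> M"
  proof (rule ccontr)
    \<comment> \<open>Otherwise \<open>C - {0}\<close> would contain a nonempty set that could be
      added to \<open>B\<close>, against maximality.\<close>
    assume "\<not> ?thesis"
    then have large: "M \<le> multiplicative_energy (C - {0})" by simp
    have "finite (C - {0})" "0 \<notin> C - {0}" "card (C - {0}) \<le> card A"
      using assms mono[of "C - {0}"] by (auto simp: C_def)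
    from ex_subset_small_additive_energy[OF this assms(2,3) large]
    obtain A' where A': "A' \<subseteq> C - {0}" "A' \<noteq> {}" "additive_energy A' \<le> k * card A' ^ 4"
      unfolding k_def by blast
    have "finite A'" using A' assms finite_subset unfolding C_def by blast
    then have "additive_energy (B \<union> A') \<le> k * card (B \<union> A') ^ 4"
      using additive_energy_union_le[of B A' k] BA A' B k0 by (auto simp: F_def C_def)
    then have "B \<union> A' \<in> F" using BA A' by (auto simp: F_def C_def)
    then have "B = B \<union> A'" by (intro max) auto
    then show False using A' by (auto simp: C_def)
  qed
  have "real (multiplicative_energy C) \<le> real (multiplicative_energy (C - {0}) + 4 * (card C)\<^sup>2)"
    using multiplicative_energy_remove_zero[of C] assms by (simp only: of_nat_le_iff C_def) simp
  also have "\<dots> \<le> M + 4 * (real (card A))\<^sup>2"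
    using small mono[of C] by (simp add: C_def add_mono power_mono)
  finally have "multiplicative_energy C \<le> M + 4 * (real (card A))\<^sup>2" .
  moreover have "additive_energy B \<le> k * card A ^ 4"
  proof -
    have "additive_energy B \<le> k * real (card B) ^ 4" using B by (simp add: F_def)
    also have "\<dots> \<le> k * real (card A) ^ 4"
      using k0 mono[of B] BA by (intro mult_left_mono power_mono) auto
    finally show ?thesis by simp
  qed
  moreover have "A = B \<union> C" "B \<inter> C = {}" using BA by (auto simp: C_def)
  ultimately show ?thesis using that unfolding k_def by blast
qed

theorem theorem7:
  shows "\<exists>K c :: real. K > 0 \<and> c > 0 \<and>
    (\<forall>A :: real set. finite A \<and> card A \<ge> 2 \<longrightarrow>
      (\<exists>B C. A = B \<union> C \<and> B \<inter> C = {} \<and>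
        real (max (additive_energy B) (multiplicative_energy C))
          \<le> K * (real (card A) powr (3 - 1 / 5) * ln (real (card A)) powr c)))"
proof -
  \<comment> \<open>\<open>L\<close> is at most twice the binary logarithm of \<open>card A\<close>,
    whence \<open>2 / ln 2\<close>; 1024 and the exponent come from the decomposition.\<close>
  define K :: real where "K = 1024 * (2 / ln 2) ^ 4"
  show ?thesis
  proof (rule exI[of _ K], rule exI[of _ 4], intro conjI allI impI)
    show "0 < K" by (simp add: K_def)
    show "(0::real) < 4" by simp
    fix A :: "real set"
    assume A: "finite A \<and> 2 \<le> card A"
    define n where "n = real (card A)"
    have n2: "2 \<le> n" using A by (simp add: n_def)
    obtain l where l: "2 ^ l \<le> card A" "card A < 2 ^ (l + 1)"
      using ex_power_ivl1[of 2 "card A"] A by auto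
    define L where "L = l + 1"
    have ln2n: "ln 2 \<le> ln n" using n2 by simp
    have "real (2 ^ l) \<le> n" using l(1) unfolding n_def of_nat_le_iff .
    then have "ln (2 ^ l) \<le> ln n" by (subst ln_le_cancel_iff) (use n2 in auto)
    then have "real L * ln 2 \<le> 2 * ln n" using ln2n by (simp add: L_def ln_realpow algebra_simps)
    then have "real L \<le> 2 / ln 2 * ln n" by (simp add: field_simps)
    then have "real L ^ 4 \<le> (2 / ln 2 * ln n) ^ 4" by (intro power_mono) auto
    then have L_le: "1024 * real L ^ 4 \<le> K * ln n ^ 4"
      unfolding K_def power_mult_distrib[of _ "ln n"] by simp
    have "1 \<le> real L ^ 4" by (simp add: L_def)
    \<comment> \<open>The value 5 is what \<open>M + 4 * n\<^sup>2 \<le> 5 * M\<close> calls for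
      below.\<close>
    with L_le have K_ge: "5 \<le> K * ln n ^ 4" by linarith
    define M where "M = n powr (3 - 1 / 5)"
    have M0: "0 < M" using n2 by (simp add: M_def)
    obtain B C where BC: "A = B \<union> C" "B \<inter> C = {}"
      and B: "additive_energy B \<le> 1024 * real L ^ 4 * (n * sqrt n) / M * n ^ 4"
      and C: "multiplicative_energy C \<le> M + 4 * n\<^sup>2"
      using additive_energy_decomposition[of A L M] A l(2) M0 unfolding L_def n_def by auto
    \<comment> \<open>The exponent equals 27/10, below the 14/5 of \<open>M\<close>.\<close>
    have "n * sqrt n / M * n ^ 4 = n powr (1 + 1 / 2 + 4 - (3 - 1 / 5))"
      using n2 unfolding M_def powr_diff powr_add powr_half_sqrt_powr
      by (simp add: powr_half_sqrt powr_numeral)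
    also have "\<dots> \<le> M" unfolding M_def using n2 by (intro powr_mono) auto
    finally have "1024 * real L ^ 4 * (n * sqrt n / M * n ^ 4) \<le> K * ln n ^ 4 * M"
      using K_ge by (intro mult_mono L_le) (use n2 M0 in auto)
    with B have B': "additive_energy B \<le> K * ln n ^ 4 * M" by (simp add: mult_ac)
    have "n\<^sup>2 = n powr 2" using n2 by (simp add: powr_numeral)
    also have "\<dots> \<le> M" unfolding M_def using n2 by (intro powr_mono) auto
    finally have "M + 4 * n\<^sup>2 \<le> 5 * M" by simp
    also have "\<dots> \<le> K * ln n ^ 4 * M" using K_ge M0 by (intro mult_right_mono) auto
    finally have C': "multiplicative_energy C \<le> K * ln n ^ 4 * M" using C by simp
    have "ln n powr 4 = ln n ^ 4" using n2 by (simp add: powr_numeral)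
    then have "max (additive_energy B) (multiplicative_energy C) \<le> K * (n powr (3 - 1 / 5) * ln n powr 4)"
      using B' C' unfolding M_def by (simp add: max_def mult_ac)
    with BC show "\<exists>B C. A = B \<union> C \<and> B \<inter> C = {} \<and> real (max (additive_energy B) (multiplicative_energy C))
        \<le> K * (real (card A) powr (3 - 1 / 5) * ln (real (card A)) powr 4)"
      unfolding n_def by blast
  qed
qed

end
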